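(* Let $A$, $B$ be Fréchet spaces and let $\phi:A\to B$ be a continuous linear map with dense image. Let $U\subseteq A$ and $V\subseteq B$ be open with $\phi(U)\subseteq V$. If $X$ is a dense (linear) subspace of $A$ such that $U\cap X=\phi^{-1}(V)\cap X$, then $\phi$ induces a weak homotopy equivalence between $U$ and $V$.
   Context: That $\phi$ induces a weak homotopy equivalence between $U$ and $V$ means that $\phi|_U:U\to V$ induces a bijection $\pi_0(U)\to\pi_0(V)$ and bijections $\pi_k(U,a)\to\pi_k(V,\phi(a))$ for all $k\ge1$ and all $a\in U$. *)

theory Defs
  imports "HOL-Analysis.Analysis"
begin

section \<open>Frechet spaces\<close>

text \<open>
  The complete translation-invariant metric is only required to exist; it is not part of the
  structure. The Hausdorff property follows from metrizability. In the class specification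
  \<open>convex\<close> and \<open>euclidean\<close> have to be written out.
\<close>

class frechet_space = real_vector + topological_ab_group_add +
  assumes tendsto_scaleR_nhds:
    "LIM p (nhds r \<times>\<^sub>F nhds x). fst p *\<^sub>R snd p :> nhds (r *\<^sub>R x)"
  assumes locally_convex:
    "open W \<Longrightarrow> 0 \<in> W \<Longrightarrow>
      \<exists>C. open C \<and>
          (\<forall>x\<in>C. \<forall>y\<in>C. \<forall>u\<ge>0. \<forall>v\<ge>0. u + v = 1 \<longrightarrow> u *\<^sub>R x + v *\<^sub>R y \<in> C) \<and>
          0 \<in> C \<and> C \<subseteq> W"
  assumes complete_invariant_metric:
    "\<exists>d. Metric_space UNIV d \<and> Metric_space.mtopology UNIV d = topology open \<and>
         Metric_space.mcomplete UNIV d \<and> (\<forall>x y z. d (x + z) (y + z) = d x y)"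

lemma open_convex_nhd_0:
  fixes W :: "'a::frechet_space set"
  assumes "open W" and "0 \<in> W"
  obtains C where "open C" "convex C" "0 \<in> C" "C \<subseteq> W"
  using locally_convex[OF assms] unfolding convex_def by blast

instance banach \<subseteq> frechet_space
proof
  fix r :: real and x :: 'a
  show "LIM p (nhds r \<times>\<^sub>F nhds x). fst p *\<^sub>R snd p :> nhds (r *\<^sub>R x)"
    by (intro tendsto_scaleR filterlim_fst filterlim_snd)
next
  fix W :: "'a set"
  assume "open W" "0 \<in> W"
  then obtain e where "e > 0" "ball 0 e \<subseteq> W"
    using open_contains_ball by blast
  then have "open (ball (0 :: 'a) e) \<and> convex (ball (0 :: 'a) e) \<and> 0 \<in> ball 0 e \<and> ball 0 e \<subseteq> W"
    by simp
  then show "\<exists>C. open C \<and>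
          (\<forall>x\<in>C. \<forall>y\<in>C. \<forall>u\<ge>0. \<forall>v\<ge>0. u + v = 1 \<longrightarrow> u *\<^sub>R x + v *\<^sub>R y \<in> C) \<and>
          0 \<in> C \<and> C \<subseteq> W"
    unfolding convex_def by blast
next
  have "Metric_space.mcomplete (UNIV :: 'a set) dist"
    by (simp add: mcomplete_iff_complete complete_UNIV)
  then show "\<exists>d. Metric_space (UNIV :: 'a set) d \<and> Metric_space.mtopology UNIV d = topology open \<and>
         Metric_space.mcomplete UNIV d \<and> (\<forall>x y z. d (x + z) (y + z) = d x y)"
    using Met_TC.Metric_space_axioms mtopology_is_euclidean by (intro exI[of _ dist]) simp
qed

section \<open>The set of path components as a functor\<close>

definition pi0_map :: "'b topology \<Rightarrow> ('a \<Rightarrow> 'b) \<Rightarrow> 'a set \<Rightarrow> 'b set" where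
  "pi0_map T \<phi> C = (\<Union>x\<in>C. path_component_of_set T (\<phi> x))"

lemma pi0_map_path_component_of_set:
  assumes "continuous_map S T \<phi>" and "x \<in> topspace S"
  shows "pi0_map T \<phi> (path_component_of_set S x) = path_component_of_set T (\<phi> x)"
proof -
  have "path_component_of T (\<phi> x) (\<phi> y)" if "path_component_of S x y" for y
    using that pathin_compose[OF _ assms(1)] unfolding path_component_of_def by fastforce
  moreover have "path_component_of S x x"
    using assms(2) by (simp add: path_component_of_refl)
  ultimately show ?thesis
    unfolding pi0_map_def by (auto intro: path_component_of_trans path_component_of_sym)
qed

section \<open>Homotopy groups, as sets\<close>

text \<open>
  The set \<open>\<pi>\<^sub>k(T, a)\<close> consists of the homotopy classes relative to \<open>\<partial>I\<^sup>k\<close> of maps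
  \<open>(I\<^sup>k, \<partial>I\<^sup>k) \<rightarrow> (T, a)\<close>. A representative is a function on the whole ambient type;
  functions that agree on \<open>I\<^sup>k\<close> are homotopic, so its values elsewhere do not matter.
\<close>

definition cube :: "nat \<Rightarrow> (nat \<Rightarrow> real) topology" where
  "cube k = product_topology (\<lambda>i. top_of_set {0..1}) {..<k}"

definition cube_boundary :: "nat \<Rightarrow> (nat \<Rightarrow> real) set" where
  "cube_boundary k = {x \<in> topspace (cube k). \<exists>i<k. x i = 0 \<or> x i = 1}"

definition spheroids :: "nat \<Rightarrow> 'a topology \<Rightarrow> 'a \<Rightarrow> ((nat \<Rightarrow> real) \<Rightarrow> 'a) set" where
  "spheroids k T a = {f. continuous_map (cube k) T f \<and> (\<forall>x\<in>cube_boundary k. f x = a)}"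

definition spheroid_homotopy ::
    "nat \<Rightarrow> 'a topology \<Rightarrow> 'a \<Rightarrow> (((nat \<Rightarrow> real) \<Rightarrow> 'a) \<times> ((nat \<Rightarrow> real) \<Rightarrow> 'a)) set" where
  "spheroid_homotopy k T a =
     {(f, g). homotopic_with (\<lambda>h. \<forall>x\<in>cube_boundary k. h x = a) (cube k) T f g}"

definition homotopy_group :: "nat \<Rightarrow> 'a topology \<Rightarrow> 'a \<Rightarrow> ((nat \<Rightarrow> real) \<Rightarrow> 'a) set set" where
  "homotopy_group k T a = spheroids k T a // spheroid_homotopy k T a"

text \<open>
  The map \<open>\<pi>\<^sub>k(S, a) \<rightarrow> \<pi>\<^sub>k(T, \<phi> a)\<close>, \<open>[f] \<mapsto> [\<phi> \<circ> f]\<close>.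
\<close>

definition homotopy_group_map ::
    "nat \<Rightarrow> 'b topology \<Rightarrow> 'a \<Rightarrow> ('a \<Rightarrow> 'b) \<Rightarrow> ((nat \<Rightarrow> real) \<Rightarrow> 'a) set \<Rightarrow> ((nat \<Rightarrow> real) \<Rightarrow> 'b) set" where
  "homotopy_group_map k T a \<phi> C = spheroid_homotopy k T (\<phi> a) `` ((\<circ>) \<phi> ` C)"

lemma equiv_spheroid_homotopy: "equiv (spheroids k T a) (spheroid_homotopy k T a)"
proof (rule equivI)
  show "spheroid_homotopy k T a \<subseteq> spheroids k T a \<times> spheroids k T a"
  proof clarify
    fix f g
    assume "(f, g) \<in> spheroid_homotopy k T a"
    then have h: "homotopic_with (\<lambda>h. \<forall>x\<in>cube_boundary k. h x = a) (cube k) T f g"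
      by (simp add: spheroid_homotopy_def)
    show "f \<in> spheroids k T a \<and> g \<in> spheroids k T a"
      using homotopic_with_imp_continuous_maps[OF h] homotopic_with_imp_property[OF h]
      by (simp add: spheroids_def)
  qed
  show "refl_on (spheroids k T a) (spheroid_homotopy k T a)"
    by (auto simp: refl_on_def spheroid_homotopy_def spheroids_def)
  show "sym (spheroid_homotopy k T a)"
    by (auto simp: sym_def spheroid_homotopy_def homotopic_with_sym)
  show "trans (spheroid_homotopy k T a)"
    by (auto simp: trans_def spheroid_homotopy_def intro: homotopic_with_trans)
qed

lemma homotopy_group_map_class:
  assumes "continuous_map S T \<phi>" and "f \<in> spheroids k S a"
  shows "homotopy_group_map k T a \<phi> (spheroid_homotopy k S a `` {f}) =
         spheroid_homotopy k T (\<phi> a) `` {\<phi> \<circ> f}"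
proof -
  have *: "(\<phi> \<circ> f, \<phi> \<circ> g) \<in> spheroid_homotopy k T (\<phi> a)" if "(f, g) \<in> spheroid_homotopy k S a" for g
    using that assms(1) unfolding spheroid_homotopy_def
    by (auto intro: homotopic_with_compose_continuous_map_left)
  have "(f, f) \<in> spheroid_homotopy k S a"
    using assms(2) equiv_spheroid_homotopy by (meson equivE refl_onD)
  then have "homotopy_group_map k T a \<phi> (spheroid_homotopy k S a `` {f}) =
      (\<Union>g\<in>spheroid_homotopy k S a `` {f}. spheroid_homotopy k T (\<phi> a) `` {\<phi> \<circ> g})"
    unfolding homotopy_group_map_def by auto
  also have "\<dots> = (\<Union>g\<in>spheroid_homotopy k S a `` {f}. spheroid_homotopy k T (\<phi> a) `` {\<phi> \<circ> f})"
  proof (rule SUP_cong)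
    fix g
    assume "g \<in> spheroid_homotopy k S a `` {f}"
    then have "(f, g) \<in> spheroid_homotopy k S a"
      by simp
    from equiv_class_eq[OF equiv_spheroid_homotopy *[OF this]]
    show "spheroid_homotopy k T (\<phi> a) `` {\<phi> \<circ> g} = spheroid_homotopy k T (\<phi> a) `` {\<phi> \<circ> f}"
      by (rule sym)
  qed simp
  also have "\<dots> = spheroid_homotopy k T (\<phi> a) `` {\<phi> \<circ> f}"
    using \<open>(f, f) \<in> spheroid_homotopy k S a\<close> by (intro UN_constant[THEN trans]) auto
  finally show ?thesis .
qed

section \<open>Weak homotopy equivalences\<close>

definition weak_homotopy_equivalence :: "'a topology \<Rightarrow> 'b topology \<Rightarrow> ('a \<Rightarrow> 'b) \<Rightarrow> bool" where
  "weak_homotopy_equivalence S T \<phi> \<longleftrightarrow>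
     continuous_map S T \<phi> \<and>
     bij_betw (pi0_map T \<phi>) (path_components_of S) (path_components_of T) \<and>
     (\<forall>k\<ge>1. \<forall>a\<in>topspace S.
        bij_betw (homotopy_group_map k T a \<phi>) (homotopy_group k S a) (homotopy_group k T (\<phi> a)))"

end

theory Submission
  imports Defs
begin

text \<open>
  Both injectivity and surjectivity on \<open>\<pi>\<^sub>k\<close> are instances of a relative lifting property: if
  \<open>f : K \<rightarrow> A\<close> maps a closed set \<open>L\<close> into \<open>U\<close>, and \<open>F : K \<rightarrow> V\<close> agrees with \<open>\<phi> \<circ> f\<close> on \<open>L\<close>,
  then \<open>f\<close> restricted to \<open>L\<close> extends to some \<open>G : K \<rightarrow> U\<close> with \<open>\<phi> \<circ> G\<close> homotopic to \<open>F\<close>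
  relative to \<open>L\<close>. To build \<open>G\<close>, approximate \<open>f\<close> by a map \<open>p\<close> and \<open>F\<close> by \<open>\<phi> \<circ> q\<close>, where \<open>p\<close> and
  \<open>q\<close> take values in \<open>X\<close>, and move away from \<open>L\<close> first along the segment from \<open>f\<close> to \<open>p\<close>, which
  stays in \<open>U\<close> near \<open>L\<close>, and then along the segment from \<open>p\<close> to \<open>q\<close>. The latter stays in \<open>X\<close>, so
  it lies in \<open>U\<close> as soon as its image lies in \<open>V\<close>, and that image remains close to \<open>F\<close>.
\<close>

section \<open>Continuous maps into Frechet spaces\<close>

lemma continuous_map_scaleR_frechet:
  fixes g :: "'k \<Rightarrow> 'a::frechet_space"
  assumes "continuous_map K euclideanreal r" and "continuous_map K euclidean g"
  shows "continuous_map K euclidean (\<lambda>x. r x *\<^sub>R g x)"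
  unfolding continuous_map_atin limitin_canonical_iff
proof
  fix x assume "x \<in> topspace K"
  then have "(r \<longlongrightarrow> r x) (atin K x)" "(g \<longlongrightarrow> g x) (atin K x)"
    using assms by (simp_all add: continuous_map_atin)
  then have "((\<lambda>y. (r y, g y)) \<longlongrightarrow> (r x, g x)) (atin K x)"
    by (rule tendsto_Pair)
  with filterlim_compose[OF tendsto_scaleR_nhds[of "r x" "g x"]]
  show "((\<lambda>y. r y *\<^sub>R g y) \<longlongrightarrow> r x *\<^sub>R g x) (atin K x)"
    by (fastforce simp: nhds_prod)
qed

lemma continuous_map_add_group:
  fixes f g :: "'k \<Rightarrow> 'a::topological_ab_group_add"
  assumes "continuous_map K euclidean f" and "continuous_map K euclidean g"
  shows "continuous_map K euclidean (\<lambda>x. f x + g x)"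
  using assms by (simp add: continuous_map_atin tendsto_add)

lemma continuous_map_diff_group:
  fixes f g :: "'k \<Rightarrow> 'a::topological_ab_group_add"
  assumes "continuous_map K euclidean f" and "continuous_map K euclidean g"
  shows "continuous_map K euclidean (\<lambda>x. f x - g x)"
  using assms by (simp add: continuous_map_atin tendsto_diff)

lemma continuous_map_sum_group:
  fixes f :: "'i \<Rightarrow> 'k \<Rightarrow> 'a::topological_ab_group_add"
  assumes "\<And>i. i \<in> I \<Longrightarrow> continuous_map K euclidean (f i)"
  shows "continuous_map K euclidean (\<lambda>x. \<Sum>i\<in>I. f i x)"
  using assms by (simp add: continuous_map_atin tendsto_sum)

lemmas continuous_map_frechet =
  continuous_map_scaleR_frechet continuous_map_add_group continuous_map_diff_group

section \<open>Convex neighbourhoods of zero in place of a norm\<close>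

text \<open>The tube lemma applies to the open set of pairs \<open>(c, x)\<close> with
  \<open>x + c\<close> in \<open>W\<close>, which contains \<open>{0} \<times> Q\<close>; local
  convexity then shrinks the base of the tube to a convex \<open>C\<close>. This stands in for a
  positive distance from \<open>Q\<close> to the complement of \<open>W\<close>.\<close>

lemma compact_subset_open_add_convex:
  fixes W :: "'a::frechet_space set"
  assumes "compact Q" and "open W" and "Q \<subseteq> W"
  obtains C where "open C" "convex C" "0 \<in> C" "\<And>x c. x \<in> Q \<Longrightarrow> c \<in> C \<Longrightarrow> x + c \<in> W"
proof -
  define P where "P = {p :: 'a \<times> 'a. snd p + fst p \<in> W}"
  have P: "open P"
    unfolding P_def using assms(2)
    by (intro continuous_open_preimage[OF _ open_UNIV, simplified vimage_def Int_UNIV_left]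
          continuous_intros)
  have "{0} \<times> Q \<subseteq> P"
    using assms(3) by (auto simp: P_def)
  from Elementary_Topology.tube_lemma[OF assms(1) P this]
  obtain N where N: "open N" "0 \<in> N" "N \<times> Q \<subseteq> P"
    by blast
  obtain C where "open C" "convex C" "0 \<in> C" "C \<subseteq> N"
    using open_convex_nhd_0 N by blast
  with N that show thesis
    by (fastforce simp: P_def)
qed

text \<open>Half of \<open>C\<close> serves as \<open>D\<close>, since \<open>x + y\<close> is the
  midpoint of \<open>2 *\<^sub>R x\<close> and \<open>2 *\<^sub>R y\<close>. This replaces the usual
  halving of an error bound.\<close>

lemma open_convex_half:
  fixes C :: "'a::frechet_space set"
  assumes "open C" and "convex C" and "0 \<in> C"
  obtains D where "open D" "convex D" "0 \<in> D" "\<And>x y. x \<in> D \<Longrightarrow> y \<in> D \<Longrightarrow> x + y \<in> C"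
proof
  define D where "D = {x. 2 *\<^sub>R x \<in> C}"
  have sum: "x + y \<in> C" if "x \<in> D" "y \<in> D" for x y
    using convexD[OF assms(2), of "2 *\<^sub>R x" "2 *\<^sub>R y" "1/2" "1/2"] that by (simp add: D_def)
  have "continuous_map euclidean euclidean (\<lambda>x::'a. 2 *\<^sub>R x)"
    by (intro continuous_map_frechet) auto
  then show "open D"
    using open_vimage[OF assms(1)] by (simp add: D_def vimage_def)
  have lin: "linear (\<lambda>x::'a. 2 *\<^sub>R x)"
    by (simp add: linear_scale_self)
  show "convex D"
    using convex_linear_vimage[OF lin assms(2)] by (simp add: D_def vimage_def)
  show "0 \<in> D"
    using assms by (simp add: D_def)
  show "\<And>x y. x \<in> D \<Longrightarrow> y \<in> D \<Longrightarrow> x + y \<in> C"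
    by (fact sum)
qed

lemma convex_scaleR_mem:
  fixes C :: "'a::real_vector set"
  assumes "convex C" "0 \<in> C" "x \<in> C" "0 \<le> t" "t \<le> 1"
  shows "t *\<^sub>R x \<in> C"
  using convexD[OF assms(1,3,2), of t "1 - t"] assms(4,5) by simp

section \<open>Approximation by maps with values in a dense subspace\<close>

text \<open>A partition of unity: near each point some constant \<open>\<psi> y\<close> with
  \<open>y\<close> in \<open>X\<close> approximates \<open>h\<close>, compactness leaves finitely
  many of them, and convexity of \<open>C\<close> allows averaging. Later \<open>\<psi>\<close> is
  the identity once and \<open>\<phi>\<close> once.\<close>

lemma approximation_by_dense_subspace:
  fixes \<psi> :: "'a::frechet_space \<Rightarrow> 'b::frechet_space"
  assumes K: "compact_space K" "Hausdorff_space K"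
    and h: "continuous_map K euclidean h"
    and \<psi>: "linear \<psi>" and X: "subspace X" and dense: "closure (\<psi> ` X) = UNIV"
    and C: "open C" "convex C" "0 \<in> C"
  obtains q where "continuous_map K euclidean q"
    "\<And>x. x \<in> topspace K \<Longrightarrow> q x \<in> X"
    "\<And>x. x \<in> topspace K \<Longrightarrow> \<psi> (q x) - h x \<in> C"
proof -
  \<comment> \<open>\<open>w\<close> is a bump function at \<open>x\<close>, vanishing wherever
    \<open>\<psi> y\<close> fails to approximate \<open>h\<close>.\<close>
  have "\<exists>y w. y \<in> X \<and> continuous_map K euclideanreal w \<and> (\<forall>x'\<in>topspace K. 0 \<le> w x') \<and> 0 < w x \<and>
      (\<forall>x'\<in>topspace K. 0 < w x' \<longrightarrow> \<psi> y - h x' \<in> C)" (is "\<exists>y w. ?P x y w")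
    if x: "x \<in> topspace K" for x
  proof -
    have "continuous_on UNIV (\<lambda>b. b - h x)"
      by (intro continuous_intros)
    then have "open ((\<lambda>b. b - h x) -` C)"
      using C(1) by (simp add: open_vimage)
    moreover have "h x \<in> (\<lambda>b. b - h x) -` C \<inter> closure (\<psi> ` X)"
      using C dense by simp
    ultimately obtain y where y: "y \<in> X" "\<psi> y - h x \<in> C"
      using open_Int_closure_eq_empty by blast
    define R where "R = {x' \<in> topspace K. \<psi> y - h x' \<in> C}"
    have "continuous_map K euclidean (\<lambda>x'. \<psi> y - h x')"
      using h by (intro continuous_map_frechet) auto
    then have "openin K R"
      unfolding R_def by (rule openin_continuous_map_preimage) (use C in simp)
    moreover have "completely_regular_space K"
      using K by (simp add: compact_Hausdorff_or_regular_imp_normal_space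
          normal_imp_completely_regular_space_gen Hausdorff_imp_t1_space
          normal_imp_completely_regular_space)
    ultimately obtain f where f: "continuous_map K (top_of_set {0..1}) f" "f x = (0::real)"
      "f ` (topspace K - R) \<subseteq> {1}"
      using x y(2) unfolding completely_regular_space_def
      by (metis (no_types, lifting) DiffD2 DiffI R_def closedin_diff closedin_topspace mem_Collect_eq)
    show ?thesis
    proof (intro exI conjI ballI impI)
      show "y \<in> X" by (fact y)
      show "continuous_map K euclideanreal (\<lambda>x. 1 - f x)"
        using f(1) by (intro continuous_intros) (auto simp: continuous_map_in_subtopology)
      show "0 \<le> 1 - f x'" if "x' \<in> topspace K" for x'
        using f(1) that by (auto simp: continuous_map_in_subtopology)
      show "0 < 1 - f x" by (simp add: f)
      show "\<psi> y - h x' \<in> C" if "x' \<in> topspace K" "0 < 1 - f x'" for x'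
        using that f(3) by (force simp: R_def)
    qed
  qed
  then obtain y w where "\<And>x. x \<in> topspace K \<Longrightarrow> ?P x (y x) (w x)"
    by metis
  then have y: "\<And>x. x \<in> topspace K \<Longrightarrow> y x \<in> X"
    and w: "\<And>x. x \<in> topspace K \<Longrightarrow> continuous_map K euclideanreal (w x)"
      "\<And>x x'. x \<in> topspace K \<Longrightarrow> x' \<in> topspace K \<Longrightarrow> (0::real) \<le> w x x'"
      "\<And>x. x \<in> topspace K \<Longrightarrow> 0 < w x x"
      "\<And>x x'. x \<in> topspace K \<Longrightarrow> x' \<in> topspace K \<Longrightarrow> 0 < w x x' \<Longrightarrow> \<psi> (y x) - h x' \<in> C"
    by blast+
  define R where "R i = {x \<in> topspace K. 0 < w i x}" for i
  have "openin K (R i)" if "i \<in> topspace K" for i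
  proof -
    have "R i = {x \<in> topspace K. w i x \<in> {0<..}}"
      by (auto simp: R_def)
    then show ?thesis
      using openin_continuous_map_preimage[OF w(1)[OF that], of "{0<..}"] by simp
  qed
  moreover have "topspace K \<subseteq> \<Union> (R ` topspace K)"
    using w(3) by (auto simp: R_def)
  ultimately obtain \<F> where \<F>: "finite \<F>" "\<F> \<subseteq> R ` topspace K" "topspace K \<subseteq> \<Union>\<F>"
    using K(1) unfolding compact_space_alt by (metis (no_types, lifting) imageE)
  then obtain I where I: "finite I" "I \<subseteq> topspace K" "topspace K \<subseteq> \<Union> (R ` I)"
    by (metis finite_subset_image)
  define s where "s x = (\<Sum>i\<in>I. w i x)" for x
  have s: "0 < s x" if x: "x \<in> topspace K" for x
  proof -
    obtain i where "i \<in> I" "0 < w i x"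
      using I(3) x by (auto simp: R_def)
    then show ?thesis
      unfolding s_def using I w(2) x by (intro sum_pos2[of I i]) auto
  qed
  \<comment> \<open>The sets \<open>R i\<close> with \<open>i\<close> in \<open>I\<close> cover
    \<open>K\<close>, so \<open>s\<close> is positive there and the quotients form a partition of
    unity.\<close>
  define q where "q x = (\<Sum>i\<in>I. (w i x / s x) *\<^sub>R y i)" for x
  show thesis
  proof
    have "continuous_map K euclideanreal s"
      unfolding s_def using I w(1) by (intro continuous_map_sum) auto
    then show "continuous_map K euclidean q"
      unfolding q_def using I w(1) s
      by (intro continuous_map_sum_group continuous_map_frechet continuous_map_real_divide)
        (auto simp: less_imp_neq[symmetric] dest: s)
    show "q x \<in> X" if "x \<in> topspace K" for x
      unfolding q_def using X I(2) y by (intro subspace_sum subspace_scale) auto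
    show "\<psi> (q x) - h x \<in> C" if x: "x \<in> topspace K" for x
    proof -
      have one: "(\<Sum>i\<in>I. w i x / s x) = 1"
        using s[OF x] by (simp add: s_def flip: sum_divide_distrib)
      have "\<psi> (q x) - h x = (\<Sum>i\<in>I. (w i x / s x) *\<^sub>R \<psi> (y i)) - (\<Sum>i\<in>I. w i x / s x) *\<^sub>R h x"
        using \<psi> by (simp add: q_def linear_sum linear_scale one)
      also have "\<dots> = (\<Sum>i\<in>I. (w i x / s x) *\<^sub>R (\<psi> (y i) - h x))"
        by (simp add: scaleR_diff_right sum_subtractf scaleR_sum_left)
      \<comment> \<open>Where a weight vanishes, nothing is known about
        \<open>\<psi> (y i) - h x\<close>. Replacing it by \<open>0\<close>, which lies in
        \<open>C\<close>, gives a convex combination of points of \<open>C\<close>.\<close>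
      also have "\<dots> = (\<Sum>i\<in>I. (w i x / s x) *\<^sub>R (if 0 < w i x then \<psi> (y i) - h x else 0))"
      proof (rule sum.cong)
        fix i assume "i \<in> I"
        then have "0 \<le> w i x" using I w(2) x by auto
        then show "(w i x / s x) *\<^sub>R (\<psi> (y i) - h x) =
            (w i x / s x) *\<^sub>R (if 0 < w i x then \<psi> (y i) - h x else 0)"
          by auto
      qed simp
      also have "\<dots> \<in> C"
        using I C s[OF x] w(2,4) x one
        by (intro convex_sum) (auto intro!: divide_nonneg_pos)
      finally show ?thesis .
    qed
  qed
qed

section \<open>The relative lifting property\<close>

lemma relative_lifting:
  fixes \<phi> :: "'a::frechet_space \<Rightarrow> 'b::frechet_space"
  assumes \<phi>: "linear \<phi>" "continuous_on UNIV \<phi>" "closure (range \<phi>) = UNIV"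
    and UV: "open U" "open V" "\<phi> ` U \<subseteq> V"
    and X: "subspace X" "closure X = UNIV" "U \<inter> X = \<phi> -` V \<inter> X"
    and K: "compact_space K" "Hausdorff_space K" and L: "closedin K L"
    and f: "continuous_map K euclidean f" "f ` L \<subseteq> U"
    and F: "continuous_map K (top_of_set V) F" "\<And>x. x \<in> L \<Longrightarrow> F x = \<phi> (f x)"
  obtains G where "continuous_map K (top_of_set U) G" "\<And>x. x \<in> L \<Longrightarrow> G x = f x"
    "homotopic_with (\<lambda>h. \<forall>x\<in>L. h x = \<phi> (f x)) K (top_of_set V) (\<phi> \<circ> G) F"
proof -
  have \<phi>_cont: "continuous_map K' euclidean (\<lambda>x. \<phi> (g x))" if "continuous_map K' euclidean g"
    for K' :: "'d topology" and g
    using continuous_map_compose[OF that, of euclidean \<phi>] \<phi>(2) by (simp add: o_def)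
  have F': "continuous_map K euclidean F" "F ` topspace K \<subseteq> V"
    using F(1) by (auto simp: continuous_map_in_subtopology)
  have LK: "L \<subseteq> topspace K"
    using L by (rule closedin_subset)
  \<comment> \<open>Continuity makes the image of \<open>X\<close> dense in the range of
    \<open>\<phi>\<close>, which is itself dense.\<close>
  have dense: "closure (\<phi> ` X) = UNIV"
  proof -
    have "range \<phi> \<subseteq> closure (\<phi> ` X)"
      using image_closure_subset[of X \<phi> "closure (\<phi> ` X)"] \<phi>(2) X(2) closure_subset[of "\<phi> ` X"]
      by (simp only: closed_closure)
    then show ?thesis
      using \<phi>(3) closure_minimal[of "range \<phi>" "closure (\<phi> ` X)"] by auto
  qed
  have comp: "compact (F ` topspace K)"
    using image_compactin[OF _ F'(1)] K(1) by (simp add: compact_space_def)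
  then obtain C where C: "open C" "convex C" "0 \<in> C"
    and CV: "\<And>x c. x \<in> topspace K \<Longrightarrow> c \<in> C \<Longrightarrow> F x + c \<in> V"
    using compact_subset_open_add_convex[OF comp UV(2) F'(2)] by (metis imageI)
  \<comment> \<open>An error in \<open>C\<close> is allowed against \<open>F\<close>. It will be the
    sum of two errors in \<open>D\<close>: that of \<open>\<phi> (f x)\<close> and the image of a
    perturbation of \<open>f x\<close>.\<close>
  obtain D where D: "open D" "convex D" "0 \<in> D"
    and DC: "\<And>x y. x \<in> D \<Longrightarrow> y \<in> D \<Longrightarrow> x + y \<in> C"
    using open_convex_half[OF C] by blast
  \<comment> \<open>On \<open>L\<close> the difference is \<open>0\<close>, so \<open>N\<close> is
    an open neighbourhood of \<open>L\<close> on which \<open>f\<close> is still a good starting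
    point.\<close>
  define N where "N = {x \<in> topspace K. f x \<in> U} \<inter> {x \<in> topspace K. \<phi> (f x) - F x \<in> D}"
  have "openin K N"
    unfolding N_def
    by (intro openin_Int openin_continuous_map_preimage[where Y = euclidean]
        continuous_map_frechet \<phi>_cont f F') (use UV D in auto)
  moreover have "L \<subseteq> N"
    using LK f F D by (auto simp: N_def)
  moreover have "normal_space K"
    using K by (simp add: compact_Hausdorff_or_regular_imp_normal_space)
  \<comment> \<open>\<open>l\<close> is the clock of the deformation: values up to
    \<open>1/2\<close> govern the segment from \<open>f\<close> to \<open>p\<close>, larger ones
    that from \<open>p\<close> to \<open>q\<close>.\<close>
  ultimately obtain l where l: "continuous_map K (top_of_set {0..1}) l" "l ` L \<subseteq> {0::real}"
    "l ` (topspace K - N) \<subseteq> {1}"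
    using Urysohn_lemma[of K L "topspace K - N" 0 1] L
    by (metis Diff_disjoint closedin_diff closedin_topspace disjnt_def disjnt_iff zero_le_one DiffE subsetD)
  have l': "continuous_map K euclideanreal l" "\<And>x. x \<in> topspace K \<Longrightarrow> 0 \<le> l x \<and> l x \<le> 1"
    using l(1) by (auto simp: continuous_map_in_subtopology)
  \<comment> \<open>The first segment is used exactly over \<open>M\<close>, a closed subset of
    \<open>N\<close>. Its compactness yields a single \<open>E0\<close> that keeps
    \<open>f + E0\<close> in \<open>U\<close> over all of \<open>M\<close>.\<close>
  define M where "M = {x \<in> topspace K. l x \<in> {..1/2}}"
  have "closedin K M"
    unfolding M_def using l'(1) by (rule closedin_continuous_map_preimage) simp
  then have "compact (f ` M)"
    using image_compactin[OF _ f(1)] K(1) closedin_compact_space by fastforce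
  moreover have "f ` M \<subseteq> U"
    using l(3) by (force simp: M_def N_def)
  ultimately obtain E0 where E0: "open E0" "convex E0" "0 \<in> E0"
    and E0U: "\<And>x c. x \<in> M \<Longrightarrow> c \<in> E0 \<Longrightarrow> f x + c \<in> U"
    using compact_subset_open_add_convex[OF _ UV(1)] by (metis imageI)
  \<comment> \<open>Over \<open>M\<close>, a displacement of \<open>f\<close> in \<open>E\<close>
    stays in \<open>U\<close>, and its image under \<open>\<phi>\<close> is a displacement in
    \<open>D\<close>.\<close>
  define E where "E = E0 \<inter> \<phi> -` D"
  have E: "open E" "convex E" "0 \<in> E"
    unfolding E_def using E0 D \<phi> open_vimage[OF D(1) \<phi>(2)] convex_linear_vimage[OF \<phi>(1) D(2)]
    by (auto simp: convex_Int linear_0)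
  obtain p where p: "continuous_map K euclidean p" "\<And>x. x \<in> topspace K \<Longrightarrow> p x \<in> X"
      "\<And>x. x \<in> topspace K \<Longrightarrow> p x - f x \<in> E"
    using approximation_by_dense_subspace[OF K f(1) linear_id X(1) _ E] X(2) by auto
  obtain q where q: "continuous_map K euclidean q" "\<And>x. x \<in> topspace K \<Longrightarrow> q x \<in> X"
      "\<And>x. x \<in> topspace K \<Longrightarrow> \<phi> (q x) - F x \<in> C"
    using approximation_by_dense_subspace[OF K F'(1) \<phi>(1) X(1) dense C] by auto
  \<comment> \<open>\<open>\<alpha>\<close> reaches \<open>1\<close> at \<open>l x = 1/2\<close>,
    and only from there on does \<open>\<beta>\<close> leave \<open>0\<close>.\<close>
  define \<alpha> \<beta> where "\<alpha> x = min 1 (2 * l x)" and "\<beta> x = max 0 (2 * l x - 1)" for x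
  have cont: "continuous_map K euclideanreal \<alpha>" "continuous_map K euclideanreal \<beta>"
    unfolding \<alpha>_def \<beta>_def by (intro continuous_intros l')+
  \<comment> \<open>One formula for both segments, so continuity needs no gluing:
    \<open>\<beta> x = 0\<close> gives the first and \<open>\<alpha> x = 1\<close> the
    second.\<close>
  define G where "G x = f x + \<alpha> x *\<^sub>R (p x + \<beta> x *\<^sub>R (q x - p x) - f x)" for x
  have G_cont: "continuous_map K euclidean G"
    unfolding G_def by (intro continuous_map_frechet f p q cont)
  have G_cases: "\<phi> (G x) - F x \<in> C \<and> G x \<in> U" if x: "x \<in> topspace K" for x
  proof (cases "l x \<le> 1/2")
    case True
    have xM: "x \<in> M" using x True by (simp add: M_def)
    have xN: "x \<in> N" using l(3) x True by force
    have \<alpha>: "0 \<le> \<alpha> x" "\<alpha> x \<le> 1" using l'(2)[OF x] by (auto simp: \<alpha>_def)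
    have Gx: "G x = f x + \<alpha> x *\<^sub>R (p x - f x)"
      using True by (simp add: G_def \<beta>_def)
    have *: "\<alpha> x *\<^sub>R (p x - f x) \<in> E"
      using convex_scaleR_mem[OF E(2,3) p(3)[OF x] \<alpha>] .
    have "\<phi> (G x) - F x = (\<phi> (f x) - F x) + \<phi> (\<alpha> x *\<^sub>R (p x - f x))"
      using \<phi>(1) by (simp add: Gx linear_add)
    also have "\<dots> \<in> C"
      using * xN by (intro DC) (auto simp: E_def N_def)
    finally show ?thesis
      using * E0U[OF xM] by (auto simp: Gx E_def)
  next
    case False
    have \<alpha>: "\<alpha> x = 1" and \<beta>: "0 \<le> \<beta> x" "\<beta> x \<le> 1"
      using False l'(2)[OF x] by (auto simp: \<alpha>_def \<beta>_def)
    have Gx: "G x = (1 - \<beta> x) *\<^sub>R p x + \<beta> x *\<^sub>R q x"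
      by (simp add: G_def \<alpha> algebra_simps)
    have "\<phi> (G x) - F x \<in> C"
    \<comment> \<open>Off \<open>N\<close> there is no bound on \<open>\<phi> (p x) - F x\<close>,
      but there \<open>l x = 1\<close>, so the second segment has already arrived at
      \<open>q x\<close>.\<close>
    proof (cases "l x = 1")
      case True
      then have "G x = q x" by (simp add: Gx \<beta>_def)
      then show ?thesis using q(3)[OF x] by simp
    next
      case False
      then have xN: "x \<in> N" using l(3) x by force
      have "\<phi> (p x) - F x = (\<phi> (f x) - F x) + \<phi> (p x - f x)"
        using \<phi>(1) by (simp add: linear_diff)
      also have "\<dots> \<in> C"
        using p(3)[OF x] xN by (intro DC) (auto simp: E_def N_def)
      finally have "(1 - \<beta> x) *\<^sub>R (\<phi> (p x) - F x) + \<beta> x *\<^sub>R (\<phi> (q x) - F x) \<in> C"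
        using \<beta> q(3)[OF x] by (intro convexD[OF C(2)]) auto
      moreover have "(1 - \<beta> x) *\<^sub>R (\<phi> (p x) - F x) + \<beta> x *\<^sub>R (\<phi> (q x) - F x) = \<phi> (G x) - F x"
        unfolding Gx linear_add[OF \<phi>(1)] linear_scale[OF \<phi>(1)] by (simp add: algebra_simps)
      ultimately show ?thesis by simp
    qed
    moreover from this have "\<phi> (G x) \<in> V"
      using CV[OF x, of "\<phi> (G x) - F x"] by simp
    moreover have "G x \<in> X"
      unfolding Gx using X(1) p(2)[OF x] q(2)[OF x] by (intro subspace_add subspace_scale)
    ultimately show ?thesis
      using X(3) by auto
  qed
  have GL: "G x = f x" if "x \<in> L" for x
    using l(2) that by (force simp: G_def \<alpha>_def)
  let ?I = "top_of_set {0..1::real}"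
  \<comment> \<open>The straight-line homotopy from \<open>\<phi> \<circ> G\<close> to
    \<open>F\<close>. It stays in \<open>F + C\<close> since \<open>C\<close> is convex and contains
    \<open>0\<close>, and it is constant on \<open>L\<close> because its two ends agree
    there.\<close>
  define H where "H = (\<lambda>z. F (snd z) + (1 - fst z) *\<^sub>R (\<phi> (G (snd z)) - F (snd z)))"
  have snd: "continuous_map (prod_topology ?I K) euclidean (\<lambda>z. g (snd z))"
    if "continuous_map K euclidean g" for g :: "'c \<Rightarrow> 'e::topological_space"
    using continuous_map_compose[OF continuous_map_snd that] by (simp add: o_def)
  have "continuous_map (prod_topology ?I K) euclideanreal fst"
    using continuous_map_fst continuous_map_into_fulltopology by blast
  then have "continuous_map (prod_topology ?I K) euclidean H"
    unfolding H_def
    by (intro continuous_map_frechet snd \<phi>_cont G_cont F' continuous_map_diff) auto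
  moreover have "H z \<in> V" if "z \<in> topspace (prod_topology ?I K)" for z
    unfolding H_def using that C G_cases by (intro CV convex_scaleR_mem) auto
  ultimately have "continuous_map (prod_topology ?I K) (top_of_set V) H"
    by (auto simp: continuous_map_in_subtopology)
  moreover have "H (t, x) = \<phi> (f x)" if "x \<in> L" for t x
    using that by (simp add: H_def GL F)
  ultimately have "homotopic_with (\<lambda>h. \<forall>x\<in>L. h x = \<phi> (f x)) K (top_of_set V) (\<phi> \<circ> G) F"
    unfolding homotopic_with_def by (intro exI[of _ H]) (auto simp: H_def)
  moreover have "continuous_map K (top_of_set U) G"
    using G_cont G_cases by (auto simp: continuous_map_in_subtopology)
  ultimately show thesis
    using that GL by blast
qed

section \<open>Homotopy groups and path components\<close>

lemma compact_space_cube: "compact_space (cube k)"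
  by (simp add: cube_def compact_space_product_topology compact_space_subtopology)

lemma Hausdorff_space_cube: "Hausdorff_space (cube k)"
  by (simp add: cube_def Hausdorff_space_product_topology Hausdorff_space_subtopology)

lemma closedin_cube_boundary: "closedin (cube k) (cube_boundary k)"
proof -
  have *: "continuous_map (cube k) euclideanreal (\<lambda>x. x i)" if "i < k" for i
    using continuous_map_product_projection[of i "{..<k}" "\<lambda>i. top_of_set {0..1::real}"] that
    by (auto simp: cube_def intro: continuous_map_into_fulltopology)
  have "cube_boundary k = (\<Union>i<k. {x \<in> topspace (cube k). x i \<in> {0,1}})"
    by (auto simp: cube_boundary_def)
  also have "closedin (cube k) \<dots>"
    by (intro closedin_Union)
      (auto intro!: closedin_continuous_map_preimage[OF *, of _ "{0, 1}", simplified])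
  finally show ?thesis .
qed

section \<open>Bijectivity tested on representatives\<close>

text \<open>The class of \<open>f\<close> goes to the class of \<open>\<phi> \<circ> f\<close>, so
  injectivity and surjectivity on classes reduce to statements about spheroids, the form in which
  lifting applies.\<close>

lemma bij_betw_homotopy_group_mapI:
  assumes \<phi>: "continuous_map S T \<phi>"
    and inj: "\<And>f g. f \<in> spheroids k S a \<Longrightarrow> g \<in> spheroids k S a \<Longrightarrow>
      (\<phi> \<circ> f, \<phi> \<circ> g) \<in> spheroid_homotopy k T (\<phi> a) \<Longrightarrow> (f, g) \<in> spheroid_homotopy k S a"
    and surj: "\<And>g. g \<in> spheroids k T (\<phi> a) \<Longrightarrow>
      \<exists>f\<in>spheroids k S a. (\<phi> \<circ> f, g) \<in> spheroid_homotopy k T (\<phi> a)"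
  shows "bij_betw (homotopy_group_map k T a \<phi>) (homotopy_group k S a) (homotopy_group k T (\<phi> a))"
proof -
  note eq = equiv_spheroid_homotopy
  have comp: "\<phi> \<circ> f \<in> spheroids k T (\<phi> a)" if "f \<in> spheroids k S a" for f
    using that \<phi> by (auto simp: spheroids_def continuous_map_compose)
  have "inj_on (homotopy_group_map k T a \<phi>) (homotopy_group k S a)"
  proof (rule inj_onI)
    fix A B assume "A \<in> homotopy_group k S a" "B \<in> homotopy_group k S a"
      and AB: "homotopy_group_map k T a \<phi> A = homotopy_group_map k T a \<phi> B"
    then obtain f g where fg: "f \<in> spheroids k S a" "g \<in> spheroids k S a"
      and A: "A = spheroid_homotopy k S a `` {f}" and B: "B = spheroid_homotopy k S a `` {g}"
      unfolding homotopy_group_def by (elim quotientE)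
    from AB have "(\<phi> \<circ> f, \<phi> \<circ> g) \<in> spheroid_homotopy k T (\<phi> a)"
      unfolding A B homotopy_group_map_class[OF \<phi> fg(1)] homotopy_group_map_class[OF \<phi> fg(2)]
      using eq_equiv_class[OF _ eq comp[OF fg(2)]] by blast
    then show "A = B"
      unfolding A B by (intro equiv_class_eq[OF eq] inj[OF fg])
  qed
  moreover have "homotopy_group_map k T a \<phi> ` homotopy_group k S a = homotopy_group k T (\<phi> a)"
  proof (intro equalityI subsetI)
    fix B assume "B \<in> homotopy_group_map k T a \<phi> ` homotopy_group k S a"
    then obtain f where "f \<in> spheroids k S a"
      "B = homotopy_group_map k T a \<phi> (spheroid_homotopy k S a `` {f})"
      unfolding homotopy_group_def by (auto elim: quotientE)
    then show "B \<in> homotopy_group k T (\<phi> a)"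
      using homotopy_group_map_class[OF \<phi>] comp by (simp add: homotopy_group_def quotientI)
  next
    fix B assume "B \<in> homotopy_group k T (\<phi> a)"
    then obtain g where g: "g \<in> spheroids k T (\<phi> a)" "B = spheroid_homotopy k T (\<phi> a) `` {g}"
      unfolding homotopy_group_def by (elim quotientE)
    then obtain f where f: "f \<in> spheroids k S a" "(\<phi> \<circ> f, g) \<in> spheroid_homotopy k T (\<phi> a)"
      using surj by blast
    then have "B = homotopy_group_map k T a \<phi> (spheroid_homotopy k S a `` {f})"
      using g homotopy_group_map_class[OF \<phi>] equiv_class_eq[OF eq] by metis
    then show "B \<in> homotopy_group_map k T a \<phi> ` homotopy_group k S a"
      using f(1) by (auto simp: homotopy_group_def quotientI)
  qed
  ultimately show ?thesis
    by (simp add: bij_betw_def)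
qed

text \<open>The same reduction for path components, with points as representatives.\<close>

lemma bij_betw_pi0_mapI:
  assumes \<phi>: "continuous_map S T \<phi>"
    and inj: "\<And>x y. x \<in> topspace S \<Longrightarrow> y \<in> topspace S \<Longrightarrow>
      path_component_of T (\<phi> x) (\<phi> y) \<Longrightarrow> path_component_of S x y"
    and surj: "\<And>y. y \<in> topspace T \<Longrightarrow> \<exists>x\<in>topspace S. path_component_of T (\<phi> x) y"
  shows "bij_betw (pi0_map T \<phi>) (path_components_of S) (path_components_of T)"
proof -
  have \<phi>S: "\<phi> x \<in> topspace T" if "x \<in> topspace S" for x
    using \<phi> that by (auto simp: continuous_map_def)
  note map = pi0_map_path_component_of_set[OF \<phi>]
  have "inj_on (pi0_map T \<phi>) (path_components_of S)"
    unfolding path_components_of_def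
  proof (rule inj_onI, clarify)
    fix x y assume xy: "x \<in> topspace S" "y \<in> topspace S"
      and "pi0_map T \<phi> (path_component_of_set S x) = pi0_map T \<phi> (path_component_of_set S y)"
    then have "path_component_of T (\<phi> x) (\<phi> y)"
      using \<phi>S map path_component_of_equiv[of T "\<phi> x" "\<phi> y"] by (metis Collect_inj)
    with xy show "path_component_of_set S x = path_component_of_set S y"
      using inj path_component_of_equiv by metis
  qed
  moreover have "pi0_map T \<phi> ` path_components_of S = path_components_of T"
  proof -
    have "path_component_of_set T y \<in> (\<lambda>x. path_component_of_set T (\<phi> x)) ` topspace S"
      if "y \<in> topspace T" for y
      using surj[OF that] path_component_of_equiv by (metis (no_types, lifting) image_eqI)
    then show ?thesis
      using \<phi>S map by (auto simp: path_components_of_def image_image)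
  qed
  ultimately show ?thesis
    by (simp add: bij_betw_def)
qed

section \<open>The four applications of the lifting property\<close>

theorem lemma5p1:
  fixes \<phi> :: "'a::frechet_space \<Rightarrow> 'b::frechet_space"
    and U X :: "'a set" and V :: "'b set"
  assumes "linear \<phi>" and "continuous_on UNIV \<phi>" and "closure (range \<phi>) = UNIV"
    and "open U" and "open V" and "\<phi> ` U \<subseteq> V"
    and "subspace X" and "closure X = UNIV"
    and "U \<inter> X = \<phi> -` V \<inter> X"
  shows "weak_homotopy_equivalence (top_of_set U) (top_of_set V) \<phi>"
proof -
  note lift = relative_lifting[OF assms]
  let ?I = "top_of_set {0..1::real}"
  have \<phi>: "continuous_map (top_of_set U) (top_of_set V) \<phi>"
    using assms by (auto intro: continuous_on_subset)
  have fst: "continuous_map (prod_topology ?I K) euclideanreal fst" for K :: "'c topology"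
    using continuous_map_fst continuous_map_into_fulltopology by blast
  have "bij_betw (pi0_map (top_of_set V) \<phi>)
      (path_components_of (top_of_set U)) (path_components_of (top_of_set V))"
  proof (rule bij_betw_pi0_mapI[OF \<phi>])
    fix x y assume xy: "x \<in> topspace (top_of_set U)" "y \<in> topspace (top_of_set U)"
      and "path_component_of (top_of_set V) (\<phi> x) (\<phi> y)"
    then obtain F where F: "continuous_map ?I (top_of_set V) F" "F 0 = \<phi> x" "F 1 = \<phi> y"
      by (auto simp: path_component_of_def pathin_def simp del: continuous_map_subtopology_eu)
    \<comment> \<open>The segment may leave \<open>U\<close> in between: with
      \<open>L = {0, 1}\<close> only its endpoints have to lie in \<open>U\<close>.\<close>
    define f where "f t = (1 - t) *\<^sub>R x + t *\<^sub>R y" for t :: real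
    have "continuous_map ?I euclidean f"
      unfolding f_def by (intro continuous_map_frechet continuous_map_diff) auto
    moreover have "compact_space ?I" "Hausdorff_space ?I" "closedin ?I {0, 1}"
      by (auto simp: compact_space_subtopology Hausdorff_space_subtopology intro!: closed_subset)
    moreover have "f ` {0, 1} \<subseteq> U" "\<And>t. t \<in> {0, 1} \<Longrightarrow> F t = \<phi> (f t)"
      using xy F by (auto simp: f_def)
    ultimately obtain G where "continuous_map ?I (top_of_set U) G" "\<And>t. t \<in> {0, 1} \<Longrightarrow> G t = f t"
      using F(1) lift[of ?I "{0, 1}" f F] by metis
    then show "path_component_of (top_of_set U) x y"
      by (auto simp: path_component_of_def pathin_def f_def simp del: continuous_map_subtopology_eu
          intro!: exI[of _ G])
  next
    fix y assume y: "y \<in> topspace (top_of_set V)"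
    \<comment> \<open>A one-point \<open>K\<close> with \<open>L\<close> empty: any \<open>f\<close>
      is admissible, so the constant \<open>0\<close> is taken, and the homotopy on a point is a
      path from \<open>\<phi> (G 0)\<close> to \<open>y\<close>.\<close>
    let ?K = "top_of_set {0::real}"
    obtain G where G: "continuous_map ?K (top_of_set U) G"
      "homotopic_with (\<lambda>h. \<forall>x\<in>{}. h x = \<phi> 0) ?K (top_of_set V) (\<phi> \<circ> G) (\<lambda>_. y)"
      using y by (auto intro: lift[of ?K "{}" "\<lambda>_. 0" "\<lambda>_. y"]
          simp: compact_space_subtopology Hausdorff_space_subtopology)
    obtain H where H: "continuous_map (prod_topology ?I ?K) (top_of_set V) H"
      "\<And>x. H (0, x) = \<phi> (G x)" "\<And>x. H (1, x) = y"
      using G(2) by (auto simp: homotopic_with_def)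
    have "continuous_map ?I (prod_topology ?I ?K) (\<lambda>t. (t, 0))"
      by (auto simp: continuous_map_pairwise o_def intro!: continuous_intros)
    from continuous_map_compose[OF this H(1)]
    have "pathin (top_of_set V) (\<lambda>t. H (t, 0))"
      by (simp add: pathin_def o_def)
    then have "path_component_of (top_of_set V) (\<phi> (G 0)) y"
      using H unfolding path_component_of_def by blast
    then show "\<exists>x\<in>topspace (top_of_set U). path_component_of (top_of_set V) (\<phi> x) y"
      using G(1) by (intro bexI[of _ "G 0"]) auto
  qed
  moreover have "bij_betw (homotopy_group_map k (top_of_set V) a \<phi>)
      (homotopy_group k (top_of_set U) a) (homotopy_group k (top_of_set V) (\<phi> a))"
    if a: "a \<in> topspace (top_of_set U)" for k a
  proof (rule bij_betw_homotopy_group_mapI[OF \<phi>])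
    let ?K = "prod_topology ?I (cube k)"
    \<comment> \<open>The two ends and the side of the cylinder over the cube. Prescribing
      \<open>f\<close>, \<open>g\<close> and \<open>a\<close> there makes an extension a homotopy
      relative to the boundary.\<close>
    let ?L = "{z \<in> topspace ?K. fst z \<in> {0, 1}} \<union> {z \<in> topspace ?K. snd z \<in> cube_boundary k}"
    fix f g assume fg: "f \<in> spheroids k (top_of_set U) a" "g \<in> spheroids k (top_of_set U) a"
      and "(\<phi> \<circ> f, \<phi> \<circ> g) \<in> spheroid_homotopy k (top_of_set V) (\<phi> a)"
    then obtain F where F: "continuous_map ?K (top_of_set V) F"
      "\<And>x. F (0, x) = \<phi> (f x)" "\<And>x. F (1, x) = \<phi> (g x)"
      "\<And>t x. t \<in> {0..1} \<Longrightarrow> x \<in> cube_boundary k \<Longrightarrow> F (t, x) = \<phi> a"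
      by (auto simp: spheroid_homotopy_def homotopic_with_def)
    have fgU: "continuous_map (cube k) euclidean f" "continuous_map (cube k) euclidean g"
      "\<And>x. x \<in> topspace (cube k) \<Longrightarrow> f x \<in> U \<and> g x \<in> U"
      and fga: "\<And>x. x \<in> cube_boundary k \<Longrightarrow> f x = a \<and> g x = a"
      using fg by (auto simp: spheroids_def continuous_map_in_subtopology)
    \<comment> \<open>A straight-line homotopy in the ambient space, possibly leaving
      \<open>U\<close> away from \<open>?L\<close>.\<close>
    define h where "h z = (1 - fst z) *\<^sub>R f (snd z) + fst z *\<^sub>R g (snd z)" for z
    have h_side: "h (t, x) = a" if "x \<in> cube_boundary k" for t x
      using fga[OF that] by (simp add: h_def algebra_simps)
    have snd: "continuous_map ?K euclidean (\<lambda>z. u (snd z))"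
      if "continuous_map (cube k) euclidean u" for u :: "(nat \<Rightarrow> real) \<Rightarrow> 'a"
      using continuous_map_compose[OF continuous_map_snd that] by (simp add: o_def)
    have h: "continuous_map ?K euclidean h"
      unfolding h_def by (intro continuous_map_frechet continuous_map_diff snd fgU fst) auto
    have L: "closedin ?K ?L"
      by (intro closedin_Un closedin_continuous_map_preimage[OF fst]
          closedin_continuous_map_preimage[OF continuous_map_snd] closedin_cube_boundary) auto
    have hL: "h ` ?L \<subseteq> U"
    proof clarify
      fix t x assume tx: "(t, x) \<in> ?L"
      show "h (t, x) \<in> U"
      proof (cases "x \<in> cube_boundary k")
        case True
        then show ?thesis using h_side a by simp
      next
        case False
        then show ?thesis using tx fgU(3) by (auto simp: h_def)
      qed
    qed
    have FL: "F z = \<phi> (h z)" if "z \<in> ?L" for z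
    proof (cases "snd z \<in> cube_boundary k")
      case True
      then show ?thesis using that h_side[of "snd z" "fst z"] F(4)[of "fst z" "snd z"] by auto
    next
      case False
      then show ?thesis using that F(2,3) by (cases z) (auto simp: h_def)
    qed
    have K: "compact_space ?K" "Hausdorff_space ?K"
      by (simp_all add: compact_space_prod_topology Hausdorff_space_prod_topology compact_space_cube
          Hausdorff_space_cube compact_space_subtopology Hausdorff_space_subtopology)
    have "\<exists>G. continuous_map ?K (top_of_set U) G \<and> (\<forall>z\<in>?L. G z = h z)"
    proof (rule lift[OF K L h hL F(1) FL])
      fix G assume "continuous_map ?K (top_of_set U) G" "\<And>z. z \<in> ?L \<Longrightarrow> G z = h z"
      then show ?thesis
        by (intro exI[of _ G] conjI ballI)
    qed
    then obtain G where G: "continuous_map ?K (top_of_set U) G" "\<forall>z\<in>?L. G z = h z"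
      by (elim exE conjE)
    have bd: "x \<in> topspace (cube k)" if "x \<in> cube_boundary k" for x
      using that by (simp add: cube_boundary_def)
    show "(f, g) \<in> spheroid_homotopy k (top_of_set U) a"
      unfolding spheroid_homotopy_def mem_Collect_eq prod.case
    \<comment> \<open>\<open>G\<close> is known to agree with \<open>h\<close> only on
      \<open>?L\<close>, hence the characterisation that compares maps on the cube alone. It applies
      because the boundary condition looks only at points of the cube.\<close>
    proof (subst homotopic_with)
      show "\<exists>G. continuous_map ?K (top_of_set U) G \<and>
          (\<forall>x\<in>topspace (cube k). G (0, x) = f x) \<and> (\<forall>x\<in>topspace (cube k). G (1, x) = g x) \<and>
          (\<forall>t\<in>{0..1}. \<forall>x\<in>cube_boundary k. G (t, x) = a)"
        using G by (intro exI[of _ G]) (auto simp: h_side bd, auto simp: h_def)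
    qed (auto simp: bd)
  next
    fix g assume g: "g \<in> spheroids k (top_of_set V) (\<phi> a)"
    \<comment> \<open>Lifting starts from the constant map \<open>a\<close>, whose image agrees with
      \<open>g\<close> on the boundary of the cube.\<close>
    obtain G where "continuous_map (cube k) (top_of_set U) G"
      "\<And>x. x \<in> cube_boundary k \<Longrightarrow> G x = a"
      "homotopic_with (\<lambda>h. \<forall>x\<in>cube_boundary k. h x = \<phi> a) (cube k) (top_of_set V) (\<phi> \<circ> G) g"
      using g a
      by (auto simp: spheroids_def intro: lift[OF compact_space_cube Hausdorff_space_cube
          closedin_cube_boundary, where f = "\<lambda>_. a" and F = g])
    then show "\<exists>f\<in>spheroids k (top_of_set U) a.
        (\<phi> \<circ> f, g) \<in> spheroid_homotopy k (top_of_set V) (\<phi> a)"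
      by (intro bexI[of _ G]) (auto simp: spheroids_def spheroid_homotopy_def)
  qed
  ultimately show ?thesis
    using \<phi> by (simp add: weak_homotopy_equivalence_def)
qed

end
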